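(* For each of the four continued fractions $K(q)$, $S_1(q)$, $S_2(q)$ and $S_3(q)$ given by $$K(q) = 1 + \cfrac{q}{1 + \cfrac{q^2}{1 + \cfrac{q^3}{1 + \cdots}}}, \qquad S_1(q) = 1 + \cfrac{q}{1 + \cfrac{q+q^2}{1 + \cfrac{q^3}{1 + \cfrac{q^2+q^4}{1 + \cdots}}}},$$ $$S_2(q) = 1 + \cfrac{q+q^2}{1 + \cfrac{q^4}{1 + \cfrac{q^3+q^6}{1 + \cfrac{q^8}{1+\cdots}}}}, \qquad S_3(q) = 1 + \cfrac{q+q^2}{1 + \cfrac{q^2+q^4}{1 + \cfrac{q^3+q^6}{1 + \cfrac{q^4+q^8}{1+\cdots}}}},$$ there exists an uncountable set of points on the unit circle $\{z \in \mathbb{C} : |z| = 1\}$ at which the continued fraction does not converge to a finite value.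
   Context: Each continued fraction has the form $1 + \cfrac{a_1(q)}{1 + \cfrac{a_2(q)}{1 + \cdots}}$, with partial numerators as follows. For $K$: $a_n = q^n$ for $n \geq 1$. For $S_1$: $a_{2k-1} = q^{2k-1}$ and $a_{2k} = q^{k} + q^{2k}$ for $k \geq 1$. For $S_2$: $a_{2k-1} = q^{2k-1} + q^{4k-2}$ and $a_{2k} = q^{4k}$ for $k \geq 1$. For $S_3$: $a_n = q^n + q^{2n}$ for $n \geq 1$. ($K$ is related to the Rogers-Ramanujan continued fraction $R(q)$ by $K(q) = q^{1/5}/R(q)$; $S_1, S_2, S_3$ are the Ramanujan-Selberg continued fractions.) The approximants are $P_n/Q_n$, where $P_{-1} = 1$, $P_0 = 1$, $Q_{-1} = 0$, $Q_0 = 1$, $P_n = P_{n-1} + a_n P_{n-2}$, $Q_n = Q_{n-1} + a_n Q_{n-2}$ for $n \geq 1$. The continued fraction converges to a finite value at $y$ if there is $L \in \mathbb{C}$ with $\lim_{n\to\infty} P_n(y)/Q_n(y) = L$ (in particular $Q_n(y) \neq 0$ for all sufficiently large $n$). *)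

theory Defs
  imports "HOL-Analysis.Analysis"
begin

(* Continued fraction 1 + a 1 / (1 + a 2 / (1 + ...)); the value a 0 is never used.
   The indices of the approximants start at -1 with P = 1, Q = 0; since this index is not
   a natural number, the step n = 1 of each recurrence is written out separately. *)

fun cf_P :: "(nat \<Rightarrow> complex) \<Rightarrow> nat \<Rightarrow> complex" where
  "cf_P a 0 = 1"
| "cf_P a (Suc 0) = cf_P a 0 + a 1 * 1"
| "cf_P a (Suc (Suc n)) = cf_P a (Suc n) + a (Suc (Suc n)) * cf_P a n"

fun cf_Q :: "(nat \<Rightarrow> complex) \<Rightarrow> nat \<Rightarrow> complex" where
  "cf_Q a 0 = 1"
| "cf_Q a (Suc 0) = cf_Q a 0 + a 1 * 0"
| "cf_Q a (Suc (Suc n)) = cf_Q a (Suc n) + a (Suc (Suc n)) * cf_Q a n"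

(* The first conjunct is needed because x / 0 = 0 in HOL: approximants with zero
   denominator are undefined and must not occur infinitely often. *)
definition cf_converges :: "(nat \<Rightarrow> complex) \<Rightarrow> bool" where
  "cf_converges a \<longleftrightarrow>
     (\<exists>L. (\<forall>\<^sub>F n in sequentially. cf_Q a n \<noteq> 0) \<and>
          (\<lambda>n. cf_P a n / cf_Q a n) \<longlonglongrightarrow> L)"

definition numer_K :: "complex \<Rightarrow> nat \<Rightarrow> complex" where
  "numer_K q n = q ^ n"

(* With n = 2k - 1 (odd) or n = 2k (even): k = n div 2 for even n,
   and 4k - 2 resp. 4k is 2 * n. *)

definition numer_S1 :: "complex \<Rightarrow> nat \<Rightarrow> complex" where
  "numer_S1 q n = (if odd n then q ^ n else q ^ (n div 2) + q ^ n)"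

definition numer_S2 :: "complex \<Rightarrow> nat \<Rightarrow> complex" where
  "numer_S2 q n = (if odd n then q ^ n + q ^ (2 * n) else q ^ (2 * n))"

definition numer_S3 :: "complex \<Rightarrow> nat \<Rightarrow> complex" where
  "numer_S3 q n = q ^ n + q ^ (2 * n)"

end

theory Submission
  imports Defs "HOL-Computational_Algebra.Polynomial"
begin

text \<open>
  With \<open>y = z\<close> or \<open>y = z\<^sup>2\<close>, all four fractions have partial numerators
  \<open>a\<^sub>n(s) = d\<^sub>n s z\<^sup>n + s\<^sup>2 z\<^sup>2\<^sup>n\<close> at \<open>s = 1\<close>, where \<open>d\<^sub>n\<close> is \<open>0\<close> or \<open>1\<close> and depends only on the parity
  of \<open>n\<close>. Let \<open>z\<close> be a primitive \<open>m\<close>-th root of unity with \<open>m\<close> odd, so that these numerators have period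
  \<open>2m\<close>, and let \<open>\<tau>(s)\<close> be the trace of the product of the transfer matrices over one period.

  Rotating the period by two steps replaces \<open>s\<close> by \<open>s z\<^sup>2\<close>, so the polynomial \<open>\<tau>\<close>, of degree \<open>2m\<close>,
  has only the terms \<open>1\<close>, \<open>c s\<^sup>m\<close> and \<open>2 s\<^sup>2\<^sup>m\<close>; hence \<open>\<tau>(1) + \<tau>(-1) = 6\<close>. On the other hand
  \<open>a\<^sub>m\<^sub>+\<^sub>i\<close> is the conjugate of \<open>a\<^sub>m\<^sub>-\<^sub>i\<close> for real \<open>s\<close>, so cutting the period at \<open>0\<close> and \<open>m\<close> exhibits \<open>\<tau>(\<plusminus>1)\<close>
  as a sum of squared absolute values with nonnegative weights, in which \<open>Q\<^sub>m\<^sub>-\<^sub>1\<close> and \<open>Q\<^sub>m\<^sub>-\<^sub>2\<close> occur. Thus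
  \<open>|Q\<^sub>m\<^sub>-\<^sub>1 Q\<^sub>m\<^sub>-\<^sub>2| \<le> 3\<close>, and since \<open>|a\<^sub>1 \<dots> a\<^sub>m\<^sub>-\<^sub>1| = 1\<close>, the approximants with indices \<open>m - 2\<close> and
  \<open>m - 1\<close> differ by at least \<open>1/3\<close>. By the Baire category theorem the points of the circle at which
  infinitely many consecutive approximants differ by more than \<open>1/4\<close> form an uncountable set.
\<close>

section \<open>Continuants\<close>

text \<open>Indices start at \<open>1\<close>: the value \<open>a 0\<close> is never used.\<close>

fun continuant :: "(nat \<Rightarrow> 'a::comm_ring_1) \<Rightarrow> nat \<Rightarrow> 'a" where
  "continuant a 0 = 1"
| "continuant a (Suc 0) = 1 + a 1"
| "continuant a (Suc (Suc n)) = continuant a (Suc n) + a (Suc (Suc n)) * continuant a n"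

abbreviation (input) shift :: "(nat \<Rightarrow> 'a) \<Rightarrow> nat \<Rightarrow> 'a" where
  "shift a \<equiv> \<lambda>i. a (Suc i)"

lemma continuant_cong:
  "(\<And>i. 1 \<le> i \<Longrightarrow> i \<le> n \<Longrightarrow> a i = b i) \<Longrightarrow> continuant a n = continuant b n"
  by (induction a n rule: continuant.induct) auto

lemma cf_Q_eq_continuant: "cf_Q a (Suc n) = continuant (shift a) n"
  by (induction a n rule: continuant.induct) auto

text \<open>Expanded, a continuant is the sum of the products of \<open>a\<close> over all sets of
  pairwise nonadjacent indices. Here these sets are sorted by whether they contain 1.\<close>

lemma continuant_left:
  "continuant a (Suc (Suc n)) = continuant (shift a) (Suc n) + a 1 * continuant (shift (shift a)) n"
proof (induction n rule: induct_nat_012)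
  case (ge2 n)
  have "continuant a (Suc (Suc (Suc (Suc n)))) =
      continuant a (Suc (Suc (Suc n))) + a (Suc (Suc (Suc (Suc n)))) * continuant a (Suc (Suc n))"
    by (rule continuant.simps)
  then show ?case
    unfolding ge2 by (simp add: algebra_simps)
qed (simp_all add: algebra_simps)

text \<open>The sets of nonadjacent indices are sorted by whether they contain the cut
  \<open>Suc (Suc m)\<close>, which excludes both of its neighbours.\<close>

lemma continuant_split:
  "continuant a (Suc (Suc (Suc m + k))) =
     continuant a (Suc m) * continuant (\<lambda>i. a (Suc (Suc m) + i)) (Suc k)
     + a (Suc (Suc m)) * continuant a m * continuant (\<lambda>i. a (Suc (Suc (Suc m)) + i)) k"
proof (induction k rule: induct_nat_012)
  case (ge2 k)
  have "continuant a (Suc (Suc (Suc m + Suc (Suc k)))) =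
      continuant a (Suc (Suc (Suc m + Suc k)))
      + a (Suc (Suc m) + Suc (Suc (Suc k))) * continuant a (Suc (Suc (Suc m + k)))"
    by simp
  then show ?case
    unfolding ge2 by (simp add: algebra_simps)
qed (simp_all add: algebra_simps)

text \<open>Reversal preserves nonadjacency. The induction matches the left expansion of
  \<open>a\<close> with the defining recurrence of the reversed sequence.\<close>

lemma continuant_reverse: "continuant (\<lambda>i. a (Suc n - i)) n = continuant a n"
proof (induction n arbitrary: a rule: less_induct)
  case (less n)
  consider "n = 0" | "n = 1" | k where "n = Suc (Suc k)"
    by (metis One_nat_def not0_implies_Suc)
  then show ?case
  proof cases
    case 3
    define b where "b = (\<lambda>i. a (Suc n - i))"
    have "continuant b (Suc k) = continuant (\<lambda>i. shift a (Suc (Suc k) - i)) (Suc k)"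
      by (rule continuant_cong) (auto simp: b_def 3 Suc_diff_le)
    also have "\<dots> = continuant (shift a) (Suc k)"
      by (rule less.IH) (simp add: 3)
    finally have 1: "continuant b (Suc k) = continuant (shift a) (Suc k)" .
    have "continuant b k = continuant (\<lambda>i. shift (shift a) (Suc k - i)) k"
      by (rule continuant_cong) (auto simp: b_def 3 Suc_diff_le)
    also have "\<dots> = continuant (shift (shift a)) k"
      by (rule less.IH) (simp add: 3)
    finally have 2: "continuant b k = continuant (shift (shift a)) k" .
    have "continuant b n = continuant a n"
      unfolding 3 continuant_left[of a] using 1 2 by (simp add: b_def 3)
    then show ?thesis by (simp add: b_def)
  qed auto
qed

lemma continuant_cnj: "continuant (\<lambda>i. cnj (a i)) n = cnj (continuant a n)"
  by (induction a n rule: continuant.induct) auto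

lemma poly_continuant: "poly (continuant A n) s = continuant (\<lambda>i. poly (A i) s) n"
  by (induction A n rule: continuant.induct) auto

section \<open>Traces over one period\<close>

text \<open>
  The trace of the product of the transfer matrices of \<open>a 1, \<dots>, a n\<close>; the second summand
  collects the terms containing \<open>a n\<close>. Meaningful only for \<open>n \<ge> 3\<close>.
\<close>

definition cyclic_continuant :: "(nat \<Rightarrow> 'a::comm_ring_1) \<Rightarrow> nat \<Rightarrow> 'a" where
  "cyclic_continuant a n = continuant a (n - 1) + a n * continuant (shift a) (n - 3)"

text \<open>A trace is invariant under cyclic rotation: both sides sum over the index sets without
  cyclically adjacent elements. Splitting off index 1 makes them agree.\<close>

lemma cyclic_continuant_shift:
  assumes "3 \<le> n" and "a (Suc n) = a 1"
  shows "cyclic_continuant (shift a) n = cyclic_continuant a n"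
proof -
  obtain k where n: "n = Suc (Suc (Suc k))"
    using le_Suc_ex[OF assms(1)] by (auto simp: numeral_3_eq_3)
  have "continuant a (Suc (Suc k)) =
      continuant (shift a) (Suc k) + a 1 * continuant (shift (shift a)) k"
    by (rule continuant_left)
  then show ?thesis
    using assms(2) by (simp add: cyclic_continuant_def n)
qed

lemma poly_cyclic_continuant:
  "poly (cyclic_continuant A n) s = cyclic_continuant (\<lambda>i. poly (A i) s) n"
  by (simp add: cyclic_continuant_def poly_continuant)

text \<open>Cut the cycle at \<open>m\<close> and \<open>2 * m\<close>. By \<open>refl\<close> the
  second arc, read backwards, is the conjugate of the first, so their continuants multiply to
  squared moduli. The four terms record which of the two cut indices are chosen.\<close>

lemma cyclic_continuant_reflection:
  assumes m: "m = Suc (Suc (Suc k))"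
    and refl: "\<And>i. i < m \<Longrightarrow> b (m + i) = cnj (b (m - i))"
    and mid: "b m = of_real \<beta>" and fin: "b (2 * m) = of_real \<alpha>"
  shows "cyclic_continuant b (2 * m) = of_real
    ((cmod (continuant b (m - 1)))\<^sup>2 + \<beta> * (cmod (continuant b (m - 2)))\<^sup>2
     + \<alpha> * (cmod (continuant (shift b) (m - 2)))\<^sup>2
     + \<alpha> * \<beta> * (cmod (continuant (shift b) (m - 3)))\<^sup>2)"
proof -
  have split1: "continuant b (2 * m - 1) =
      continuant b (m - 1) * continuant (\<lambda>i. b (m + i)) (m - 1)
      + b m * continuant b (m - 2) * continuant (\<lambda>i. b (Suc m + i)) (m - 2)"
    using continuant_split[of b "Suc k" "Suc k"] by (simp add: m mult_2 del: continuant.simps)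
  have split2: "continuant (shift b) (2 * m - 3) =
      continuant (shift b) (m - 2) * continuant (\<lambda>i. b (m + i)) (m - 2)
      + b m * continuant (shift b) (m - 3) * continuant (\<lambda>i. b (Suc m + i)) (m - 3)"
    using continuant_split[of "shift b" k k] by (simp add: m mult_2 del: continuant.simps)
  have r1: "continuant (\<lambda>i. b (m + i)) (m - 1) = cnj (continuant b (m - 1))"
    unfolding continuant_reverse[of b, symmetric] continuant_cnj[symmetric]
  proof (rule continuant_cong)
    fix i assume "1 \<le> i" "i \<le> m - 1"
    then show "b (m + i) = cnj (b (Suc (m - 1) - i))"
      using refl[of i] m by simp
  qed
  have r2: "continuant (\<lambda>i. b (Suc m + i)) (m - 2) = cnj (continuant b (m - 2))"
    unfolding continuant_reverse[of b, symmetric] continuant_cnj[symmetric]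
  proof (rule continuant_cong)
    fix i assume "1 \<le> i" "i \<le> m - 2"
    then show "b (Suc m + i) = cnj (b (Suc (m - 2) - i))"
      using refl[of "Suc i"] m by simp
  qed
  have r3: "continuant (\<lambda>i. b (m + i)) (m - 2) = cnj (continuant (shift b) (m - 2))"
    unfolding continuant_reverse[of "shift b", symmetric] continuant_cnj[symmetric]
  proof (rule continuant_cong)
    fix i assume "1 \<le> i" "i \<le> m - 2"
    then show "b (m + i) = cnj (b (Suc (Suc (m - 2) - i)))"
      using refl[of i] m by (simp add: Suc_diff_le)
  qed
  have r4: "continuant (\<lambda>i. b (Suc m + i)) (m - 3) = cnj (continuant (shift b) (m - 3))"
    unfolding continuant_reverse[of "shift b", symmetric] continuant_cnj[symmetric]
  proof (rule continuant_cong)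
    fix i assume "1 \<le> i" "i \<le> m - 3"
    then show "b (Suc m + i) = cnj (b (Suc (Suc (m - 3) - i)))"
      using refl[of "Suc i"] m by (simp add: Suc_diff_le)
  qed
  show ?thesis
    unfolding cyclic_continuant_def split1 split2 r1 r2 r3 r4 mid fin
      of_real_add of_real_mult complex_norm_square
    by (simp only: algebra_simps)
qed

section \<open>Degrees and top coefficients of polynomial continuants\<close>

lemma coeff_mult_degree_bounds:
  assumes "degree p \<le> i" "degree q \<le> j"
  shows "coeff (p * q) (i + j) = coeff p i * coeff q j"
proof -
  have "coeff (p * q) (i + j) = (\<Sum>l\<le>i + j. coeff p l * coeff q (i + j - l))"
    by (simp add: coeff_mult)
  also have "\<dots> = (\<Sum>l\<in>{i}. coeff p l * coeff q (i + j - l))"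
  proof (rule sum.mono_neutral_right)
    show "\<forall>l\<in>{..i + j} - {i}. coeff p l * coeff q (i + j - l) = 0"
    proof
      fix l assume l: "l \<in> {..i + j} - {i}"
      show "coeff p l * coeff q (i + j - l) = 0"
      proof (cases "l < i")
        case True
        then have "degree q < i + j - l" using assms(2) by simp
        then show ?thesis by (simp add: coeff_eq_0)
      next
        case False
        then have "degree p < l" using l assms(1) by auto
        then show ?thesis by (simp add: coeff_eq_0)
      qed
    qed
  qed auto
  finally show ?thesis by simp
qed

text \<open>At most \<open>k\<close> of the indices up to \<open>2 * k\<close> are pairwise
  nonadjacent; up to \<open>2 * k + 1\<close>, only the set of odd indices reaches
  \<open>k + 1\<close> elements. In the induction the even bound keeps the lower term of the
  recurrence out of the top coefficient.\<close>

lemma continuant_poly_degree: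
  assumes "\<And>i. degree (A i) \<le> 2"
  shows "degree (continuant A (2 * k)) \<le> 2 * k \<and> degree (continuant A (2 * k + 1)) \<le> 2 * k + 2
    \<and> coeff (continuant A (2 * k + 1)) (2 * k + 2) = (\<Prod>j\<le>k. coeff (A (2 * j + 1)) 2)"
proof (induction k)
  case 0
  have "degree (1 + A 1) \<le> 2"
    using assms[of 1] by (intro degree_add_le) auto
  then show ?case by (simp add: numeral_2_eq_2)
next
  case (Suc k)
  let ?C = "continuant A"
  have e: "?C (2 * Suc k) = ?C (2 * k + 1) + A (2 * k + 2) * ?C (2 * k)"
    and o: "?C (2 * Suc k + 1) = ?C (2 * Suc k) + A (2 * k + 3) * ?C (2 * k + 1)"
    by (simp_all add: numeral_3_eq_3 numeral_2_eq_2)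
  have de: "degree (?C (2 * Suc k)) \<le> 2 * Suc k"
    unfolding e using Suc assms[of "2 * k + 2"]
    by (intro degree_add_le order_trans[OF degree_mult_le]) auto
  have dm: "degree (A (2 * k + 3) * ?C (2 * k + 1)) \<le> 2 + (2 * k + 2)"
    using Suc assms[of "2 * k + 3"] by (intro order_trans[OF degree_mult_le] add_mono) auto
  have "degree (?C (2 * Suc k + 1)) \<le> 2 * Suc k + 2"
    unfolding o using de dm by (intro degree_add_le) auto
  moreover have "coeff (?C (2 * Suc k + 1)) (2 * Suc k + 2) =
      (\<Prod>j\<le>Suc k. coeff (A (2 * j + 1)) 2)"
  proof -
    have "coeff (A (2 * k + 3) * ?C (2 * k + 1)) (2 + (2 * k + 2)) =
        coeff (A (2 * k + 3)) 2 * coeff (?C (2 * k + 1)) (2 * k + 2)"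
      using Suc assms by (intro coeff_mult_degree_bounds) auto
    moreover have "coeff (?C (2 * Suc k)) (2 * Suc k + 2) = 0"
      using de by (intro coeff_eq_0) simp
    ultimately have "coeff (?C (2 * Suc k + 1)) (2 * Suc k + 2) =
        coeff (A (2 * k + 3)) 2 * (\<Prod>j\<le>k. coeff (A (2 * j + 1)) 2)"
      unfolding o coeff_add using Suc by simp
    then show ?thesis
      by (simp add: numeral_3_eq_3 mult.commute)
  qed
  ultimately show ?case
    using de by blast
qed

section \<open>Numerators at roots of unity of odd order\<close>

definition twisted :: "(nat \<Rightarrow> bool) \<Rightarrow> complex \<Rightarrow> complex \<Rightarrow> nat \<Rightarrow> complex" where
  "twisted d z s n = (if d n then s * z ^ n else 0) + s\<^sup>2 * z ^ (2 * n)"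

lemma continuant_zero: "continuant (\<lambda>i. 0) n = 1"
  by (induction n rule: induct_nat_012) auto

lemma prod_odd_exponents: "(\<Prod>j<n. x ^ (2 * (2 * j + 1))) = (x ^ (2 * n\<^sup>2) :: 'a::comm_monoid_mult)"
  by (induction n) (auto simp: power_add[symmetric] power2_eq_square algebra_simps)

lemma prod_even_exponents: "(\<Prod>j<n. x ^ (2 * (2 * j + 2))) = (x ^ (2 * n * (n + 1)) :: 'a::comm_monoid_mult)"
  by (induction n) (auto simp: power_add[symmetric] algebra_simps)

text \<open>Oddness of \<open>m\<close> makes doubling a permutation of the residues, cancels the
  middle coefficient of the trace when the values at 1 and -1 are added, and gives \<open>i\<close>
  and \<open>m - i\<close> opposite parity.\<close>

locale odd_primitive_root =
  fixes m :: nat and z :: complex and d :: "nat \<Rightarrow> bool"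
  assumes odd_m: "odd m" and m_ge_3: "3 \<le> m"
    and root: "z ^ m = 1" and primitive: "\<And>k. z ^ k = 1 \<Longrightarrow> m dvd k"
    and d_periodic: "\<And>n. d (n + 2) = d n"
begin

lemma norm_z: "norm z = 1"
  using power_eq_1_iff[OF root] m_ge_3 by simp

lemma d_add_even: "d (n + 2 * k) = d n"
proof (induction k)
  case (Suc k)
  have "d (n + 2 * Suc k) = d (n + 2 * k + 2)" by (simp add: algebra_simps)
  then show ?case using Suc d_periodic by metis
qed simp

lemma twisted_shift: "twisted d z s (Suc (Suc n)) = twisted d z (s * z\<^sup>2) n"
proof -
  have "z ^ (2 * Suc (Suc n)) = z ^ (2 * n) * (z\<^sup>2)\<^sup>2"
    by (simp add: power2_eq_square mult_ac)
  then show ?thesis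
    using d_periodic[of n] by (simp add: twisted_def power_mult_distrib power2_eq_square mult_ac)
qed

lemma power_multiple: "z ^ (k * m) = 1"
  by (simp add: power_mult mult.commute[of k] root)

lemma power_add_period: "z ^ (n + k * m) = z ^ n"
  by (simp add: power_add power_multiple)

lemma twisted_periodic: "twisted d z s (n + 2 * m) = twisted d z s n"
proof -
  have "z ^ (n + 2 * m) = z ^ n" "z ^ (2 * (n + 2 * m)) = z ^ (2 * n)"
    using power_add_period[of n 2] power_add_period[of "2 * n" 4] by (simp_all add: algebra_simps)
  then show ?thesis
    by (simp add: twisted_def d_add_even)
qed

text \<open>The indices \<open>m + i\<close> and \<open>m - i\<close> add up to
  \<open>2 * m\<close>, so the powers of \<open>z\<close> are inverse, hence conjugate on the unit
  circle. The two indices also have equal parity.\<close>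

lemma twisted_reflect:
  assumes "s \<in> \<real>" "i < m"
  shows "twisted d z s (m + i) = cnj (twisted d z s (m - i))"
proof -
  have c: "z ^ (m + i) = cnj (z ^ (m - i))"
  proof -
    have "z ^ (m - i) * z ^ (m + i) = 1"
      using assms(2) power_multiple[of 2] by (simp flip: power_add add: mult_2)
    moreover have "z ^ (m - i) * cnj (z ^ (m - i)) = 1"
      using complex_norm_square[of "z ^ (m - i)", symmetric] by (simp add: norm_power norm_z)
    ultimately show ?thesis
      by (metis mult_cancel_left zero_neq_one mult_zero_left)
  qed
  have "z ^ (2 * (m + i)) = cnj (z ^ (2 * (m - i)))"
    unfolding power_even_eq c complex_cnj_power ..
  moreover have "d (m + i) = d (m - i)"
    using d_add_even[of "m - i" i] assms(2) by (simp add: mult_2)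
  moreover have "cnj s = s"
    using assms(1) by (simp add: Reals_cnj_iff)
  ultimately show ?thesis
    using c by (simp add: twisted_def)
qed

lemma cyclic_continuant_twisted_rotate:
  "cyclic_continuant (twisted d z (s * z\<^sup>2)) (2 * m) = cyclic_continuant (twisted d z s) (2 * m)"
proof -
  let ?b = "twisted d z s"
  have per: "?b (Suc (2 * m)) = ?b 1" "?b (Suc (Suc (2 * m))) = ?b (Suc 1)"
    using twisted_periodic[of s 1] twisted_periodic[of s 2] by (simp_all add: numeral_2_eq_2)
  have "cyclic_continuant (twisted d z (s * z\<^sup>2)) (2 * m) = cyclic_continuant (shift (shift ?b)) (2 * m)"
    by (simp add: twisted_shift)
  also have "\<dots> = cyclic_continuant (shift ?b) (2 * m)"
    using m_ge_3 per by (intro cyclic_continuant_shift) auto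
  also have "\<dots> = cyclic_continuant ?b (2 * m)"
    using m_ge_3 per by (intro cyclic_continuant_shift) auto
  finally show ?thesis .
qed

lemma cyclic_continuant_twisted_sum:
  "cyclic_continuant (twisted d z 1) (2 * m) + cyclic_continuant (twisted d z (- 1)) (2 * m) = 6"
proof -
  define A where "A n = [:0, if d n then z ^ n else 0, z ^ (2 * n):]" for n
  define p where "p = cyclic_continuant A (2 * m)"
  have "poly (A n) s = twisted d z s n" for n s
    by (simp add: A_def twisted_def power2_eq_square algebra_simps)
  then have p: "poly p s = cyclic_continuant (twisted d z s) (2 * m)" for s
    by (simp add: p_def poly_cyclic_continuant)
  obtain k where k: "m = Suc (Suc k)"
    using le_Suc_ex[OF m_ge_3] by (auto simp: numeral_3_eq_3)
  have degA: "degree (A n) \<le> 2" and cA: "coeff (A n) 2 = z ^ (2 * n)" for n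
    by (auto simp: A_def numeral_2_eq_2)
  have i1: "2 * m - 1 = 2 * Suc k + 1" "2 * m - 3 = 2 * k + 1" "2 * m = 2 * Suc k + 2"
      "2 * m = 2 + (2 * k + 2)"
    by (simp_all add: k)
  \<comment> \<open>Only two sets of \<open>m\<close> indices on the cycle have no adjacent
    elements: the odd indices, coming from the first summand, and the even ones, from the second.
    Each contributes a power of \<open>z ^ m\<close>, that is 1.\<close>
  have D1: "degree (continuant A (2 * m - 1)) \<le> 2 * m"
    and C1: "coeff (continuant A (2 * m - 1)) (2 * m) = 1"
  proof -
    note * = continuant_poly_degree[of A "Suc k", OF degA]
    show "degree (continuant A (2 * m - 1)) \<le> 2 * m"
      using * i1 by metis
    have "coeff (continuant A (2 * m - 1)) (2 * m) = (\<Prod>j<m. z ^ (2 * (2 * j + 1)))"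
      using * unfolding cA i1(1,3)[symmetric] lessThan_Suc_atMost[symmetric] k[symmetric] by blast
    also have "\<dots> = (z ^ m) ^ (2 * m)"
      unfolding prod_odd_exponents by (simp add: power_mult[symmetric] power2_eq_square algebra_simps)
    finally show "coeff (continuant A (2 * m - 1)) (2 * m) = 1"
      by (simp add: root)
  qed
  have D2: "degree (A (2 * m) * continuant (shift A) (2 * m - 3)) \<le> 2 * m"
    and C2: "coeff (A (2 * m) * continuant (shift A) (2 * m - 3)) (2 * m) = 1"
  proof -
    note * = continuant_poly_degree[of "shift A" k, OF degA]
    show "degree (A (2 * m) * continuant (shift A) (2 * m - 3)) \<le> 2 * m"
      unfolding i1(2,4) using degA *
      by (intro order_trans[OF degree_mult_le] add_mono) auto
    have "coeff (A (2 * m) * continuant (shift A) (2 * m - 3)) (2 * m) =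
        coeff (A (2 * m)) 2 * coeff (continuant (shift A) (2 * k + 1)) (2 * k + 2)"
      unfolding i1(2) by (subst (2) i1(4), rule coeff_mult_degree_bounds) (use degA * in auto)
    also have "\<dots> = z ^ (4 * m) * (\<Prod>j<Suc k. z ^ (2 * (2 * j + 2)))"
      using * by (simp add: cA lessThan_Suc_atMost del: prod.lessThan_Suc prod.atMost_Suc)
    also have "\<dots> = z ^ (4 * m) * (z ^ m) ^ (2 * Suc k)"
      unfolding prod_even_exponents by (simp only: power_mult[symmetric]) (simp add: k algebra_simps)
    also have "\<dots> = 1"
      by (simp add: power_multiple root)
    finally show "coeff (A (2 * m) * continuant (shift A) (2 * m - 3)) (2 * m) = 1" .
  qed
  have deg: "degree p \<le> 2 * m"
    unfolding p_def cyclic_continuant_def using D1 D2 by (rule degree_add_le)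
  have top: "coeff p (2 * m) = 2"
    unfolding p_def cyclic_continuant_def coeff_add C1 C2 by simp
  have "twisted d z 0 = (\<lambda>i. 0)"
    by (simp add: fun_eq_iff twisted_def)
  then have "poly p 0 = 1"
    by (simp add: p cyclic_continuant_def continuant_zero)
  then have bot: "coeff p 0 = 1"
    by (simp add: poly_0_coeff_0)
  have "pcompose p [:0, z\<^sup>2:] = p"
    by (intro poly_eq_poly_eq_iff[THEN iffD1] ext)
       (simp add: poly_pcompose p cyclic_continuant_twisted_rotate)
  then have inv: "z ^ (2 * j) * coeff p j = coeff p j" for j
    by (metis coeff_pcompose_linear power_mult)
  have vanish: "coeff p j = 0" if "\<not> m dvd j" for j
  proof (rule ccontr)
    assume "coeff p j \<noteq> 0"
    then have "z ^ (2 * j) = 1" using inv[of j] by simp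
    then have "m dvd 2 * j" by (rule primitive)
    then show False using that odd_m
      by (simp add: coprime_dvd_mult_right_iff)
  qed
  have "poly p x = (\<Sum>j\<le>2 * m. coeff p j * x ^ j)" for x
    unfolding poly_altdef using deg by (intro sum.mono_neutral_left) (auto simp: coeff_eq_0)
  \<comment> \<open>Odd exponents cancel, which removes the unknown coefficient at
    \<open>m\<close>.\<close>
  then have "poly p 1 + poly p (- 1) = (\<Sum>j\<le>2 * m. coeff p j * (1 + (- 1) ^ j))"
    by (simp add: sum.distrib distrib_left)
  also have "\<dots> = (\<Sum>j\<in>{0, 2 * m}. coeff p j * (1 + (- 1) ^ j))"
  proof (rule sum.mono_neutral_right)
    show "\<forall>j\<in>{..2 * m} - {0, 2 * m}. coeff p j * (1 + (- 1) ^ j) = 0"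
    proof
      fix j assume j: "j \<in> {..2 * m} - {0, 2 * m}"
      show "coeff p j * (1 + (- 1) ^ j) = 0"
      proof (cases "m dvd j")
        case True
        then obtain q where q: "j = m * q" ..
        then have "q < 2" "0 < q" using j m_ge_3 by (auto simp: mult.commute)
        then have "j = m" using q by (simp add: less_2_cases_iff)
        then show ?thesis using odd_m by simp
      qed (simp add: vanish)
    qed
  qed auto
  also have "\<dots> = 6"
    using top bot m_ge_3 by simp
  finally show ?thesis
    by (simp add: p)
qed

lemma norm_Q_le: "norm (cf_Q (twisted d z 1) (m - 1) * cf_Q (twisted d z 1) (m - 2)) \<le> 3"
proof -
  obtain k where k: "m = Suc (Suc (Suc k))"
    using le_Suc_ex[OF m_ge_3] by (auto simp: numeral_3_eq_3)
  define F where "F \<sigma> = (let b = twisted d z (of_real \<sigma>);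
        \<beta> = (if d m then \<sigma> else 0) + 1; \<alpha> = (if d (2 * m) then \<sigma> else 0) + 1 in
      (cmod (continuant b (m - 1)))\<^sup>2 + \<beta> * (cmod (continuant b (m - 2)))\<^sup>2
     + \<alpha> * (cmod (continuant (shift b) (m - 2)))\<^sup>2
     + \<alpha> * \<beta> * (cmod (continuant (shift b) (m - 3)))\<^sup>2)" for \<sigma>
  have F: "cyclic_continuant (twisted d z (of_real \<sigma>)) (2 * m) = of_real (F \<sigma>)"
    if "\<sigma>\<^sup>2 = 1" for \<sigma>
    unfolding F_def Let_def
  proof (rule cyclic_continuant_reflection[OF k])
    have s: "(of_real \<sigma>)\<^sup>2 = (1::complex)"
      using that by (metis of_real_1 of_real_power)
    show "twisted d z (of_real \<sigma>) m = of_real ((if d m then \<sigma> else 0) + 1)"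
      by (simp add: twisted_def root power_multiple s)
    show "twisted d z (of_real \<sigma>) (2 * m) = of_real ((if d (2 * m) then \<sigma> else 0) + 1)"
      by (simp add: twisted_def power_multiple s)
  qed (simp add: twisted_reflect)
  have "complex_of_real (F 1 + F (- 1)) = 6"
    using cyclic_continuant_twisted_sum F[of 1] F[of "- 1"] by simp
  then have sum: "F 1 + F (- 1) = 6"
    by (metis of_real_eq_iff of_real_numeral)
  \<comment> \<open>At -1 the weights \<alpha> and \<beta> are 0 or 1, so \<open>F 1\<close> is at
    most 6.\<close>
  have nonneg: "0 \<le> F (- 1)"
    by (cases "d m"; cases "d (2 * m)") (simp_all add: F_def Let_def)
  let ?b = "twisted d z 1"
  have mono: "y \<le> c * y" if "1 \<le> c" "0 \<le> y" for c y :: real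
    using mult_right_mono[OF that] by simp
  \<comment> \<open>At 1 both weights are at least 1; the last two terms of \<open>F 1\<close> carry
    the denominators, which do not involve the first numerator.\<close>
  have "(cmod (continuant (shift ?b) (m - 2)))\<^sup>2 + (cmod (continuant (shift ?b) (m - 3)))\<^sup>2 \<le> F 1"
    unfolding F_def Let_def of_real_1
    by (intro add_mono add_increasing mono) auto
  then have "(cmod (cf_Q ?b (m - 1)))\<^sup>2 + (cmod (cf_Q ?b (m - 2)))\<^sup>2 \<le> 6"
    using sum nonneg by (simp add: k cf_Q_eq_continuant del: cf_Q.simps continuant.simps)
  then show ?thesis
    using sum_squares_bound[of "cmod (cf_Q ?b (m - 1))" "cmod (cf_Q ?b (m - 2))"]
    by (simp add: norm_mult)
qed

text \<open>Multiply by the product of the \<open>norm (1 - z ^ i)\<close>, nonzero by primitivity.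
  The factors become \<open>norm (1 - z ^ (2 * i))\<close>, and doubling modulo \<open>m\<close>,
  the map \<open>f\<close>, only permutes them.\<close>

lemma prod_norm_one_plus: "(\<Prod>i\<in>{1..<m}. norm (1 + z ^ i)) = 1"
proof -
  define f where "f i = (if 2 * i < m then 2 * i else 2 * i - m)" for i
  have ne: "z ^ i \<noteq> 1" if "i \<in> {1..<m}" for i
    using primitive[of i] that dvd_imp_le[of m i] by auto
  have "f ` {1..<m} \<subseteq> {1..<m}"
    using odd_m by (auto simp: f_def) presburger+
  moreover have "inj_on f {1..<m}"
    using odd_m by (auto simp: f_def inj_on_def split: if_splits) presburger+
  ultimately have bij: "bij_betw f {1..<m} {1..<m}"
    by (simp add: bij_betw_def endo_inj_surj)
  have zf: "z ^ f i = z ^ (2 * i)" for i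
    using power_add_period[of "2 * i - m" 1] by (auto simp: f_def)
  have "(\<Prod>i\<in>{1..<m}. norm (1 - z ^ i)) * (\<Prod>i\<in>{1..<m}. norm (1 + z ^ i))
      = (\<Prod>i\<in>{1..<m}. norm (1 - z ^ (2 * i)))"
  proof -
    have "(1 - z ^ i) * (1 + z ^ i) = 1 - z ^ (2 * i)" for i
      unfolding power_even_eq by algebra
    then show ?thesis
      by (simp flip: prod.distrib norm_mult)
  qed
  also have "\<dots> = (\<Prod>i\<in>{1..<m}. norm (1 - z ^ i))"
    using prod.reindex_bij_betw[OF bij, of "\<lambda>i. norm (1 - z ^ i)"] by (simp add: zf)
  finally show ?thesis
    using ne by simp
qed

text \<open>The factors at \<open>i\<close> and \<open>m - i\<close> share the value
  \<open>h i\<close>, but the indices differ in parity. Paired in the square of the product, they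
  give \<open>h i ^ e\<close>, where \<open>e\<close> counts the parities at which \<open>d\<close>
  holds.\<close>

lemma prod_norm_twisted: "(\<Prod>i\<in>{1..<m}. norm (twisted d z 1 i)) = 1"
proof -
  define h where "h i = norm (1 + z ^ i)" for i
  define g where "g i = (if d i then h i else 1)" for i
  have "norm (twisted d z 1 i) = g i" for i
  proof -
    have "z ^ i + z ^ (2 * i) = z ^ i * (1 + z ^ i)"
      unfolding power_even_eq by algebra
    then show ?thesis
      by (simp add: twisted_def g_def h_def norm_mult norm_power norm_z)
  qed
  moreover have "(\<Prod>i\<in>{1..<m}. g i) = 1"
  proof -
    define e where "e = of_bool (d 0) + (of_bool (d 1) :: nat)"
    have h_refl: "h (m - i) = h i" if "i < m" for i
    proof -
      have "z ^ i * z ^ (m - i) = 1"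
        using that root by (simp add: power_add[symmetric])
      moreover have "norm (z ^ i) = 1"
        by (simp add: norm_power norm_z)
      ultimately show ?thesis
        unfolding h_def by (metis add.commute distrib_left mult.right_neutral mult_1 norm_mult)
    qed
    have d_parity: "d i = d (if even i then 0 else 1)" for i
    proof (cases "even i")
      case True
      then show ?thesis using d_add_even[of 0 "i div 2"] by simp
    next
      case False
      then have "1 + 2 * (i div 2) = i" by presburger
      then show ?thesis using False d_add_even[of 1 "i div 2"] by simp
    qed
    have step: "g i * g (m - i) = h i ^ e" if "i \<in> {1..<m}" for i
    proof -
      have "even (m - i) \<longleftrightarrow> odd i" using odd_m that by auto
      then show ?thesis
        using h_refl[of i] that d_parity[of i] d_parity[of "m - i"]
        by (auto simp: g_def e_def power2_eq_square)
    qed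
    have "bij_betw (\<lambda>i. m - i) {1..<m} {1..<m}"
      by (rule bij_betwI[where g = "\<lambda>i. m - i"]) auto
    then have "(\<Prod>i\<in>{1..<m}. g (m - i)) = (\<Prod>i\<in>{1..<m}. g i)"
      by (rule prod.reindex_bij_betw)
    then have "(\<Prod>i\<in>{1..<m}. g i)\<^sup>2 = (\<Prod>i\<in>{1..<m}. g i * g (m - i))"
      by (simp add: power2_eq_square prod.distrib)
    also have "\<dots> = (\<Prod>i\<in>{1..<m}. h i) ^ e"
      by (simp add: step prod_power_distrib)
    also have "\<dots> = 1"
      unfolding h_def prod_norm_one_plus by simp
    finally show ?thesis
      by (simp add: power2_eq_1_iff) (smt (verit) g_def h_def norm_ge_zero prod_nonneg)
  qed
  ultimately show ?thesis by simp
qed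

end

section \<open>Gaps between consecutive approximants\<close>

text \<open>Each step multiplies the determinant by minus the new numerator. This converts bounds on
  denominators into gaps between approximants.\<close>

lemma norm_cf_determinant:
  "norm (cf_P a (Suc n) * cf_Q a n - cf_P a n * cf_Q a (Suc n)) = (\<Prod>i\<in>{1..Suc n}. norm (a i))"
proof (induction n)
  case (Suc n)
  have "cf_P a (Suc (Suc n)) * cf_Q a (Suc n) - cf_P a (Suc n) * cf_Q a (Suc (Suc n)) =
      - (a (Suc (Suc n)) * (cf_P a (Suc n) * cf_Q a n - cf_P a n * cf_Q a (Suc n)))"
    by (simp add: algebra_simps)
  then show ?case
    using Suc by (simp add: norm_mult mult.commute)
qed simp

text \<open>
  For nonzero denominators this says that the \<open>n\<close>-th and the next approximant are more than \<open>1/4\<close> apart;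
  in this form it is an open condition on the partial numerators.
\<close>

definition far_step :: "(nat \<Rightarrow> complex) \<Rightarrow> nat \<Rightarrow> bool" where
  "far_step a n \<longleftrightarrow> norm (cf_Q a (Suc n) * cf_Q a n)
     < 4 * norm (cf_P a (Suc n) * cf_Q a n - cf_P a n * cf_Q a (Suc n))"

lemma far_steps_imp_not_converges:
  assumes "\<exists>\<^sub>F n in sequentially. far_step a n"
  shows "\<not> cf_converges a"
proof
  assume "cf_converges a"
  then obtain L where ne: "\<forall>\<^sub>F n in sequentially. cf_Q a n \<noteq> 0"
      and lim: "(\<lambda>n. cf_P a n / cf_Q a n) \<longlonglongrightarrow> L"
    by (auto simp: cf_converges_def)
  have "(\<lambda>n. cf_P a (Suc n) / cf_Q a (Suc n) - cf_P a n / cf_Q a n) \<longlonglongrightarrow> L - L"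
    by (intro tendsto_diff lim LIMSEQ_Suc)
  then have "\<forall>\<^sub>F n in sequentially.
      norm (cf_P a (Suc n) / cf_Q a (Suc n) - cf_P a n / cf_Q a n) < 1 / 4"
    by (auto simp: tendsto_iff dist_norm dest: spec[of _ "1 / 4"])
  moreover have "\<forall>\<^sub>F n in sequentially. cf_Q a (Suc n) \<noteq> 0"
    using ne by (rule eventually_compose_filterlim) (rule filterlim_Suc)
  ultimately have "\<forall>\<^sub>F n in sequentially. \<not> far_step a n"
    using ne
  proof eventually_elim
    case (elim n)
    have "cf_P a (Suc n) / cf_Q a (Suc n) - cf_P a n / cf_Q a n =
        (cf_P a (Suc n) * cf_Q a n - cf_P a n * cf_Q a (Suc n)) / (cf_Q a (Suc n) * cf_Q a n)"
      using elim by (simp add: diff_frac_eq)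
    with elim(1) have "norm (cf_P a (Suc n) * cf_Q a n - cf_P a n * cf_Q a (Suc n))
        / norm (cf_Q a (Suc n) * cf_Q a n) < 1 / 4"
      by (simp only: norm_divide)
    moreover have "0 < norm (cf_Q a (Suc n) * cf_Q a n)"
      using elim by simp
    ultimately show ?case
      unfolding far_step_def by (simp only: pos_divide_less_eq)
  qed
  with assms show False
    by (simp add: frequently_def)
qed

text \<open>The determinant has norm 1, so the two sides of \<open>far_step\<close> are at most 3
  and exactly 4. The slack gives the strict inequality.\<close>

lemma (in odd_primitive_root) far_step_twisted: "far_step (twisted d z 1) (m - 2)"
proof -
  have "Suc (m - 2) = m - 1" "{1..m - 1} = {1..<m}"
    using m_ge_3 by auto
  then show ?thesis
    using norm_Q_le prod_norm_twisted norm_cf_determinant[of "twisted d z 1" "m - 2"]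
    by (simp add: far_step_def)
qed

section \<open>Baire category on the unit circle\<close>

text \<open>Continuity makes \<open>far_step\<close> an open condition on \<open>y\<close>, so each
  \<open>G N\<close> is open and dense in the circle. Points in all of them have infinitely many far
  steps.\<close>

lemma uncountable_divergence_set:
  fixes a :: "complex \<Rightarrow> nat \<Rightarrow> complex"
  assumes cont: "\<And>n. continuous_on UNIV (\<lambda>y. a y n)"
    and dense: "\<And>N. sphere 0 1 \<subseteq> closure {y \<in> sphere 0 1. \<exists>n\<ge>N. far_step (a y) n}"
  shows "\<exists>Y \<subseteq> {z. norm z = 1}. uncountable Y \<and> (\<forall>y\<in>Y. \<not> cf_converges (a y))"
proof -
  define G where "G N = {y \<in> sphere 0 1. \<exists>n\<ge>N. far_step (a y) n}" for N
  define Y where "Y = (\<Inter>N. G N)"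
  have contP: "continuous_on UNIV (\<lambda>y. cf_P (a y) n)" for n
    by (induction n rule: induct_nat_012) (auto intro!: continuous_intros cont)
  have contQ: "continuous_on UNIV (\<lambda>y. cf_Q (a y) n)" for n
    by (induction n rule: induct_nat_012) (auto intro!: continuous_intros cont)
  have "open {y. far_step (a y) n}" for n
    unfolding far_step_def by (intro open_Collect_less continuous_intros contP contQ)
  then have "open (\<Union>n\<in>{N..}. {y. far_step (a y) n})" for N
    by blast
  moreover have "G N = sphere 0 1 \<inter> (\<Union>n\<in>{N..}. {y. far_step (a y) n})" for N
    by (auto simp: G_def)
  ultimately have openG: "openin (top_of_set (sphere 0 1)) (G N)" for N
    by (auto simp: openin_open)
  \<comment> \<open>The circle is connected and has more than one point, so none of its points is
    isolated.\<close>
  have perfect: "sphere 0 1 \<subseteq> closure (sphere 0 1 - {y})" if "y \<in> sphere 0 1" for y :: complex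
  proof -
    have "sphere 0 1 \<noteq> {x}" for x :: complex
    proof
      assume "sphere 0 1 = {x}"
      moreover have "1 \<in> sphere (0::complex) 1" "- 1 \<in> sphere (0::complex) 1"
        by simp_all
      ultimately have "1 = x" "- 1 = x"
        by (simp_all only: singleton_iff)
      then show False
        by simp
    qed
    then have "y islimpt sphere 0 1"
      using that by (intro connected_imp_perfect connected_sphere) simp_all
    then have "y \<in> closure (sphere 0 1 - {y})"
      by (simp only: islimpt_in_closure)
    then show ?thesis
      using closure_subset[of "sphere 0 1 - {y}"] by blast
  qed
  have "uncountable Y"
  proof
    assume "countable Y"
    \<comment> \<open>If \<open>Y\<close> is countable, deleting its points singly adds only
      countably many dense open sets, and the enlarged family has empty intersection.\<close>
    define \<G> where "\<G> = range G \<union> (\<lambda>y. sphere 0 1 - {y}) ` Y"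
    have "countable \<G>"
      using \<open>countable Y\<close> by (simp add: \<G>_def)
    moreover have "openin (top_of_set (sphere 0 1)) T \<and> sphere 0 1 \<subseteq> closure T" if T: "T \<in> \<G>" for T
    proof (cases "T \<in> range G")
      case True
      then show ?thesis
        using openG dense by (auto simp: G_def)
    next
      case False
      then obtain y where "y \<in> Y" "T = sphere 0 1 - {y}"
        using T by (auto simp: \<G>_def)
      then show ?thesis
        using perfect[of y] by (auto simp: Y_def G_def intro: openin_delete)
    qed
    ultimately have "sphere 0 1 \<subseteq> closure (\<Inter>\<G>)"
      by (intro Baire) auto
    moreover have "\<Inter>\<G> = {}"
    proof -
      have "y \<notin> \<Inter>\<G>" for y
      proof (cases "y \<in> Y")
        case True
        then have "sphere 0 1 - {y} \<in> \<G>" by (simp add: \<G>_def)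
        then show ?thesis by blast
      next
        case False
        then show ?thesis by (auto simp: \<G>_def Y_def)
      qed
      then show ?thesis by blast
    qed
    moreover have "(1::complex) \<in> sphere 0 1"
      by simp
    ultimately show False
      by auto
  qed
  moreover have "\<not> cf_converges (a y)" if "y \<in> Y" for y
    using that by (intro far_steps_imp_not_converges)
      (auto simp: Y_def G_def frequently_sequentially)
  moreover have "Y \<subseteq> {z. norm z = 1}"
    by (auto simp: Y_def G_def)
  ultimately show ?thesis
    by blast
qed

section \<open>Density of the roots of unity\<close>

text \<open>Powers of 3 serve as orders: they are odd, at least 3 and unbounded.\<close>

lemma odd_primitive_roots_dense:
  assumes "\<And>n. d (n + 2) = d n"
  shows "sphere 0 1 \<subseteq> closure {z. \<exists>m\<ge>N. odd_primitive_root m z d}"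
proof
  fix w :: complex assume "w \<in> sphere 0 1"
  then have \<theta>: "0 \<le> Arg2pi w" "w = exp (\<i> * of_real (Arg2pi w))"
    using complex_norm_eq_1_exp[of w] by (simp_all add: Arg2pi_ge_0)
  define t where "t = Arg2pi w / (2 * pi)"
  have w: "w = exp (2 * of_real pi * \<i> * of_real t)"
    by (subst \<theta>(2)) (simp add: t_def)
  have "0 \<le> t"
    using \<theta> by (simp add: t_def)
  \<comment> \<open>The final 1 makes \<open>j k\<close> prime to 3, so \<open>\<zeta> k\<close> has
    exact order \<open>3 ^ (k + 1)\<close>; it shifts the angle by a vanishing amount.\<close>
  define j where "j k = 3 * nat \<lfloor>t * 3 ^ k\<rfloor> + 1" for k
  define x where "x k = real (j k) / real (3 ^ (k + 1))" for k
  define \<zeta> where "\<zeta> k = exp (2 * of_real pi * \<i> * of_nat (j k) / of_nat (3 ^ (k + 1)))" for k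
  have \<zeta>x: "\<zeta> k = exp (2 * of_real pi * \<i> * of_real (x k))" for k
    by (simp add: \<zeta>_def x_def)
  have x: "x k = of_int \<lfloor>t * 3 ^ k\<rfloor> / 3 ^ k + (1 / 3) ^ k / 3" for k
    using \<open>0 \<le> t\<close> by (simp add: x_def j_def field_simps)
  have bound: "\<bar>x k - t\<bar> \<le> 2 * (1 / 3) ^ k" for k
  proof -
    have "of_int \<lfloor>t * 3 ^ k\<rfloor> / 3 ^ k - t = (of_int \<lfloor>t * 3 ^ k\<rfloor> - t * 3 ^ k) / 3 ^ k"
      by (simp add: diff_divide_distrib)
    also have "\<bar>\<dots>\<bar> \<le> 1 / 3 ^ k"
      unfolding abs_divide by (intro frac_le) (auto, linarith+)
    finally have "\<bar>of_int \<lfloor>t * 3 ^ k\<rfloor> / 3 ^ k - t\<bar> \<le> (1 / 3) ^ k"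
      by (simp only: power_one_over)
    moreover have "0 \<le> (1 / 3 :: real) ^ k"
      by simp
    ultimately show ?thesis
      unfolding x by linarith
  qed
  have "(\<lambda>k. 2 * (1 / 3 :: real) ^ k) \<longlonglongrightarrow> 2 * 0"
    by (intro tendsto_mult tendsto_const LIMSEQ_power_zero) simp
  then have "(\<lambda>k. x k - t) \<longlonglongrightarrow> 0"
    unfolding mult_zero_right by (rule Lim_null_comparison[rotated]) (simp add: bound)
  then have "x \<longlonglongrightarrow> t"
    by (rule LIM_zero_cancel)
  then have lim: "\<zeta> \<longlonglongrightarrow> w"
    unfolding w \<zeta>x[abs_def] by (intro tendsto_intros)
  have "odd_primitive_root (3 ^ (k + 1)) (\<zeta> k) d" for k
  proof
    show "\<zeta> k ^ 3 ^ (k + 1) = 1"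
      unfolding \<zeta>_def by (rule complex_root_unity) simp
    fix l assume "\<zeta> k ^ l = 1"
    moreover have "\<zeta> k ^ l = exp (2 * of_real pi * \<i> * of_nat (l * j k) / of_nat (3 ^ (k + 1)))"
      unfolding \<zeta>_def exp_of_nat_mult[symmetric] by (simp add: mult_ac)
    ultimately have "3 ^ (k + 1) dvd l * j k"
      using complex_root_unity_eq_1[of "3 ^ (k + 1)" "l * j k"] by (metis one_le_numeral one_le_power)
    moreover have "coprime (3 ^ (k + 1)) (j k)"
    proof -
      have "coprime 3 (3 * nat \<lfloor>t * 3 ^ k\<rfloor> + 1)"
        by (rule coprimeI) (metis dvd_add_right_iff dvd_trans dvd_triv_left)
      then show ?thesis
        unfolding j_def by (rule coprime_power_left_iff[THEN iffD2, OF disjI1])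
    qed
    ultimately show "3 ^ (k + 1) dvd l"
      by (simp add: coprime_dvd_mult_left_iff)
  qed (use assms in auto)
  moreover have "N \<le> 3 ^ (k + N + 1)" for k
  proof -
    have "N \<le> k + N + 1" by simp
    also have "\<dots> < 3 ^ (k + N + 1)"
      by (rule power_gt_expt) simp
    finally show ?thesis by simp
  qed
  ultimately have "\<zeta> (k + N) \<in> {z. \<exists>m\<ge>N. odd_primitive_root m z d}" for k
    by blast
  then show "w \<in> closure {z. \<exists>m\<ge>N. odd_primitive_root m z d}"
    unfolding closure_sequential using LIMSEQ_ignore_initial_segment[OF lim, of N]
    by (intro exI[of _ "\<lambda>k. \<zeta> (k + N)"]) auto
qed

section \<open>The four continued fractions\<close>

text \<open>The power map is continuous and takes the circle onto itself, so it carries the dense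
  set of roots of unity to a dense set of points with far steps.\<close>

lemma twisted_family_diverges:
  fixes a :: "complex \<Rightarrow> nat \<Rightarrow> complex"
  assumes "0 < e" and d: "\<And>n. d (n + 2) = d n"
    and cont: "\<And>n. continuous_on UNIV (\<lambda>y. a y n)"
    and a: "\<And>z n. a (z ^ e) n = twisted d z 1 n"
  shows "\<exists>Y \<subseteq> {z. norm z = 1}. uncountable Y \<and> (\<forall>y\<in>Y. \<not> cf_converges (a y))"
proof (rule uncountable_divergence_set[OF cont])
  fix N
  \<comment> \<open>The far step sits at index \<open>m - 2\<close>, hence
    \<open>N + 2\<close>.\<close>
  let ?D = "{z. \<exists>m\<ge>N + 2. odd_primitive_root m z d}"
  have "sphere 0 1 \<subseteq> (\<lambda>z. z ^ e) ` sphere (0::complex) 1"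
  proof
    fix w :: complex assume "w \<in> sphere 0 1"
    then obtain \<theta> where "w = exp (\<i> * of_real \<theta>)"
      using complex_norm_eq_1_exp[of w] by (metis mem_sphere_0)
    then have "w = exp (\<i> * of_real (\<theta> / e)) ^ e"
      using \<open>0 < e\<close> by (simp flip: exp_of_nat_mult)
    then show "w \<in> (\<lambda>z. z ^ e) ` sphere 0 1"
      by (rule image_eqI) simp
  qed
  also have "\<dots> \<subseteq> (\<lambda>z. z ^ e) ` closure ?D"
    by (intro image_mono odd_primitive_roots_dense d)
  also have "\<dots> \<subseteq> closure ((\<lambda>z. z ^ e) ` ?D)"
    by (rule continuous_image_closure_subset[of UNIV]) (auto intro!: continuous_intros)
  also have "\<dots> \<subseteq> closure {y \<in> sphere 0 1. \<exists>n\<ge>N. far_step (a y) n}"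
  proof (intro closure_mono subsetI)
    fix y assume "y \<in> (\<lambda>z. z ^ e) ` ?D"
    then obtain z m where *: "y = z ^ e" "N + 2 \<le> m" "odd_primitive_root m z d"
      by auto
    have "a y = twisted d z 1"
      by (simp add: fun_eq_iff *(1) a)
    then have "far_step (a y) (m - 2)"
      using odd_primitive_root.far_step_twisted[OF *(3)] by simp
    moreover have "norm y = 1"
      using * odd_primitive_root.norm_z by (simp add: norm_power)
    ultimately show "y \<in> {y \<in> sphere 0 1. \<exists>n\<ge>N. far_step (a y) n}"
      using *(2) by (auto intro!: exI[of _ "m - 2"])
  qed
  finally show "sphere 0 1 \<subseteq> closure {y \<in> sphere 0 1. \<exists>n\<ge>N. far_step (a y) n}" .
qed

theorem corollary2:
  shows "\<forall>a \<in> {numer_K, numer_S1, numer_S2, numer_S3}.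
           \<exists>Y \<subseteq> {z :: complex. norm z = 1}. uncountable Y \<and> (\<forall>y \<in> Y. \<not> cf_converges (a y))"
proof -
  \<comment> \<open>For the first two fractions \<open>y = z ^ 2\<close> turns \<open>y ^ n\<close>
    into \<open>z ^ (2 * n)\<close> and, for even \<open>n\<close>, \<open>y ^ (n div 2)\<close>
    into \<open>z ^ n\<close>; the other two already have the required form.\<close>
  have K: "\<exists>Y \<subseteq> {z. norm z = 1}. uncountable Y \<and> (\<forall>y\<in>Y. \<not> cf_converges (numer_K y))"
    by (rule twisted_family_diverges[where e = 2 and d = "\<lambda>n. False"])
      (auto simp: numer_K_def twisted_def power_mult intro!: continuous_intros)
  have S1: "\<exists>Y \<subseteq> {z. norm z = 1}. uncountable Y \<and> (\<forall>y\<in>Y. \<not> cf_converges (numer_S1 y))"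
  proof (rule twisted_family_diverges[where e = 2 and d = even])
    show "continuous_on UNIV (\<lambda>y. numer_S1 y n)" for n
      by (cases "odd n") (auto simp: numer_S1_def intro!: continuous_intros)
  qed (auto simp: numer_S1_def twisted_def power_mult[symmetric])
  have S2: "\<exists>Y \<subseteq> {z. norm z = 1}. uncountable Y \<and> (\<forall>y\<in>Y. \<not> cf_converges (numer_S2 y))"
  proof (rule twisted_family_diverges[where e = 1 and d = odd])
    show "continuous_on UNIV (\<lambda>y. numer_S2 y n)" for n
      by (cases "odd n") (auto simp: numer_S2_def intro!: continuous_intros)
  qed (auto simp: numer_S2_def twisted_def)
  have S3: "\<exists>Y \<subseteq> {z. norm z = 1}. uncountable Y \<and> (\<forall>y\<in>Y. \<not> cf_converges (numer_S3 y))"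
    by (rule twisted_family_diverges[where e = 1 and d = "\<lambda>n. True"])
      (auto simp: numer_S3_def twisted_def intro!: continuous_intros)
  from K S1 S2 S3 show ?thesis
    by simp
qed

end
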